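(* Let $X$ be a non-negative random variable with absolutely continuous distribution function $F$ and with $E(X^2)<\infty$, and let $\alpha$ be a positive integer with $\alpha\neq1$. Then the weighted cumulative residual Tsallis entropy of order $\alpha$ satisfies $$WCRT_\alpha(X)=\frac{1}{2(\alpha-1)}\mathcal{M}_{2,0,0}-\frac{\alpha}{2(\alpha-1)}\mathcal{M}_{2,0,\alpha-1}.$$
   Context: $\bar F(x)=1-F(x)=P(X>x)$. The weighted cumulative residual Tsallis entropy of order $\alpha$ is $$WCRT_\alpha(X)=\frac{1}{\alpha-1}\int_0^\infty x\big(\bar F(x)-\bar F^\alpha(x)\big)\,dx.$$ For real $p,r,s$ for which the expectation exists, the probability weighted moment of $X$ is $\mathcal{M}_{p,r,s}=E\{X^pF^r(X)(1-F(X))^s\}$. *)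

theory Defs
  imports "HOL-Probability.Probability"
begin

(* Absolute continuity of a real function, in the classical epsilon-delta sense.
   The closed intervals {a i..b i} may touch at endpoints; only their interiors are disjoint. *)
definition abs_continuous_on :: "real set \<Rightarrow> (real \<Rightarrow> real) \<Rightarrow> bool" where
  "abs_continuous_on S f \<longleftrightarrow>
     (\<forall>\<epsilon>>0. \<exists>\<delta>>0. \<forall>(n::nat) a b.
        (\<forall>i<n. a i \<le> b i \<and> {a i..b i} \<subseteq> S) \<and>
        (\<forall>i<n. \<forall>j<n. i \<noteq> j \<longrightarrow> {a i<..<b i} \<inter> {a j<..<b j} = {}) \<and>
        (\<Sum>i<n. b i - a i) < \<delta>
        \<longrightarrow> (\<Sum>i<n. \<bar>f (b i) - f (a i)\<bar>) < \<epsilon>)"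

(* Real powers of non-negative reals with x^0 = 1 for every x; in the library 0 powr 0 = 0. *)
definition rpow :: "real \<Rightarrow> real \<Rightarrow> real" where
  "rpow x a = (if a = 0 then 1 else x powr a)"

definition distr_fun :: "'a measure \<Rightarrow> ('a \<Rightarrow> real) \<Rightarrow> real \<Rightarrow> real" where
  "distr_fun M X = cdf (distr M borel X)"

definition surv_fun :: "'a measure \<Rightarrow> ('a \<Rightarrow> real) \<Rightarrow> real \<Rightarrow> real" where
  "surv_fun M X x = 1 - distr_fun M X x"

definition WCRT :: "'a measure \<Rightarrow> real \<Rightarrow> ('a \<Rightarrow> real) \<Rightarrow> real" where
  "WCRT M \<alpha> X =
     1 / (\<alpha> - 1) *
       (LINT x:{0..}|lborel. x * (surv_fun M X x - rpow (surv_fun M X x) \<alpha>))"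

definition prob_weighted_moment ::
    "'a measure \<Rightarrow> ('a \<Rightarrow> real) \<Rightarrow> real \<Rightarrow> real \<Rightarrow> real \<Rightarrow> real" where
  "prob_weighted_moment M X p r s =
     (LINT \<omega>|M. rpow (X \<omega>) p * rpow (distr_fun M X (X \<omega>)) r
                  * rpow (1 - distr_fun M X (X \<omega>)) s)"

end

theory Submission
  imports Defs
begin

text \<open>
  Let \<open>G\<close> be the survival function. Since the law of \<open>X\<close> has no atoms, the integral of
  \<open>n G(y)^(n-1)\<close> over \<open>y > x\<close> with respect to \<open>dF(y)\<close> is \<open>G(x)^n\<close>. Inserting this into
  \<open>\<integral> x G(x)^n dx\<close> and exchanging the integrals turns it into \<open>n/2 E(X^2 G(X)^(n-1))\<close>;
  the cases \<open>n = 1\<close> and \<open>n = \<alpha>\<close> are the two moments in the theorem.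
\<close>

text \<open>The definition is tested on a single interval, the one between \<open>x\<close> and
  \<open>y\<close>. Continuity of the distribution function is what later rules out atoms of the
  law.\<close>

lemma abs_continuous_on_imp_isCont:
  assumes "abs_continuous_on UNIV f"
  shows "isCont f x"
  unfolding continuous_at_eps_delta
proof (intro allI impI)
  fix e :: real
  assume "0 < e"
  with assms obtain d where "d > 0"
    and d: "\<forall>(n::nat) a b.
        (\<forall>i<n. a i \<le> b i \<and> {a i..b i} \<subseteq> UNIV) \<and>
        (\<forall>i<n. \<forall>j<n. i \<noteq> j \<longrightarrow> {a i<..<b i} \<inter> {a j<..<b j} = {}) \<and>
        (\<Sum>i<n. b i - a i) < d \<longrightarrow> (\<Sum>i<n. \<bar>f (b i) - f (a i)\<bar>) < e"
    unfolding abs_continuous_on_def by blast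
  have "dist (f y) (f x) < e" if "dist y x < d" for y
  proof -
    have "\<bar>f (max x y) - f (min x y)\<bar> < e"
      using d[rule_format, of "Suc 0" "\<lambda>_. min x y" "\<lambda>_. max x y"] that
      by (cases "x \<le> y") (simp_all add: dist_real_def)
    then show ?thesis
      by (simp add: dist_real_def max_def min_def abs_minus_commute split: if_splits)
  qed
  with \<open>d > 0\<close> show "\<exists>d>0. \<forall>y. dist y x < d \<longrightarrow> dist (f y) (f x) < e"
    by blast
qed

text \<open>At \<open>x = 0\<close>, \<open>n = 0\<close> both sides are 1, whereas
  \<open>powr\<close> alone would give 0.\<close>

lemma rpow_of_nat:
  assumes "0 \<le> x"
  shows "rpow x (real n) = x ^ n"
  using assms by (cases "x = 0") (auto simp: rpow_def powr_realpow)

context real_distribution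
begin

lemma cdf_eq_measure_tail: "1 - cdf M x = measure M {x<..}"
proof -
  have "measure M {x<..} = 1 - measure M {..x}"
    by (subst prob_compl[symmetric]) (auto intro!: arg_cong[where f = prob])
  then show ?thesis
    by (simp add: cdf_def)
qed

lemma borel_measurable_tail [measurable]: "(\<lambda>x. measure M {x<..}) \<in> borel_measurable borel"
proof -
  have "mono (cdf M)"
    by (simp add: mono_def cdf_nondecreasing)
  then have "cdf M \<in> borel_measurable borel"
    by (rule borel_measurable_mono)
  then show ?thesis
    unfolding cdf_eq_measure_tail[symmetric] by measurable
qed

text \<open>Without atoms, formally \<open>d(G^(n+1)) = -(n+1) G^n dF\<close>. Induction with Fubini
  avoids densities and derivatives; \<open>x\<close> stays arbitrary because the induction
  hypothesis is needed at \<open>x\<close> and at \<open>z\<close>.\<close>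

lemma integral_tail_power:
  assumes no_atom: "\<And>x. measure M {x} = 0"
  shows "(LINT y|M. indicator {x<..} y * measure M {y<..} ^ n) = measure M {x<..} ^ Suc n / real (Suc n)"
proof (induction n arbitrary: x)
  case 0
  show ?case by simp
next
  case (Suc n)
  let ?G = "\<lambda>x. measure M {x<..}"
  interpret P: pair_sigma_finite M M ..
  interpret PP: pair_prob_space M M ..
  have int: "integrable M (\<lambda>y. indicator {x<..} y * ?G y ^ k)" for x k
    by (rule integrable_const_bound[where B = 1])
      (auto simp: power_le_one indicator_def)
  have intP: "integrable (M \<Otimes>\<^sub>M M) (\<lambda>(y, z). indicator {x<..} y * (indicator {y<..} z * ?G y ^ n))"
    by (rule PP.P.integrable_const_bound[where B = 1])
      (auto simp: power_le_one indicator_def split_beta)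
  \<comment> \<open>For \<open>x < z\<close> only \<open>y\<close> strictly between them
    contributes, so the integral is the difference of the induction hypothesis at \<open>x\<close>
    and at \<open>z\<close>. For \<open>z \<le> x\<close> both sides vanish.\<close>
  have inner: "(LINT y|M. indicator {x<..} y * (indicator {y<..} z * ?G y ^ n)) =
      indicator {x<..} z * (?G x ^ Suc n / real (Suc n)) - indicator {x<..} z * ?G z ^ Suc n / real (Suc n)" for z
  proof (cases "x < z")
    case True
    \<comment> \<open>The difference of the two tails is the half-open interval from
      \<open>x\<close> to \<open>z\<close>; its endpoint \<open>z\<close>, missing from the original
      integrand, carries no mass.\<close>
    have "AE y in M. y \<noteq> z"
      using no_atom by (intro AE_I[where N = "{z}"]) (auto simp: emeasure_eq_measure)
    then have "(LINT y|M. indicator {x<..} y * (indicator {y<..} z * ?G y ^ n)) =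
        (LINT y|M. indicator {x<..} y * ?G y ^ n - indicator {z<..} y * ?G y ^ n)"
      using True by (intro integral_cong_AE) (auto simp: indicator_def)
    also have "\<dots> = ?G x ^ Suc n / real (Suc n) - ?G z ^ Suc n / real (Suc n)"
      by (subst Bochner_Integration.integral_diff[OF int int]) (simp only: Suc.IH)
    finally show ?thesis
      using True by simp
  next
    case False
    then have "indicator {x<..} y * (indicator {y<..} z * ?G y ^ n) = 0" for y
      by (auto simp: indicator_def)
    then show ?thesis
      using False by (simp only:) simp
  qed
  \<comment> \<open>One factor \<open>G(y)\<close> is the integral of \<open>dF(z)\<close> over \<open>z > y\<close>; exchanging the order of
    integration makes the left-hand side reappear on the right, divided by \<open>- (n + 1)\<close>.\<close>
  have "(LINT y|M. indicator {x<..} y * ?G y ^ Suc n) =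
      (LINT y|M. LINT z|M. indicator {x<..} y * (indicator {y<..} z * ?G y ^ n))"
    by (simp add: mult_ac)
  also have "\<dots> = (LINT z|M. LINT y|M. indicator {x<..} y * (indicator {y<..} z * ?G y ^ n))"
    using P.Fubini_integral[OF intP] by simp
  also have "\<dots> = ?G x * (?G x ^ Suc n / real (Suc n)) -
      (LINT z|M. indicator {x<..} z * ?G z ^ Suc n) / real (Suc n)"
    unfolding inner using int[of x 0] int[of x "Suc n"]
    by (subst Bochner_Integration.integral_diff) (auto simp del: power_Suc)
  finally have "(LINT y|M. indicator {x<..} y * ?G y ^ Suc n) =
      ?G x ^ Suc (Suc n) / real (Suc n) - (LINT z|M. indicator {x<..} z * ?G z ^ Suc n) / real (Suc n)"
    by simp
  \<comment> \<open>Solves the linear equation for the recurring integral \<open>e\<close>; with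
    \<open>c = n + 1\<close> the new denominator is \<open>n + 2\<close>.\<close>
  moreover have "e = g / (1 + c)" if "e = g / c - e / c" "0 < c" for e g c :: real
    using that by (simp add: field_simps)
  ultimately have "(LINT y|M. indicator {x<..} y * ?G y ^ Suc n) = ?G x ^ Suc (Suc n) / (1 + real (Suc n))"
    using of_nat_0_less_iff zero_less_Suc by blast
  then show ?case
    by (simp only: of_nat_Suc)
qed

text \<open>For \<open>y \<ge> 0\<close> the integral of \<open>x\<close> over
  \<open>0 \<le> x < y\<close> is \<open>y^2 / 2\<close>; Fubini carries this under the expectation.
  The weight \<open>h\<close> will be a power of the survival function.\<close>

lemma has_bochner_integral_tail_expectation:
  fixes h :: "real \<Rightarrow> real"
  assumes [measurable]: "h \<in> borel_measurable borel"
    and h: "\<And>y. 0 \<le> h y" "\<And>y. h y \<le> 1"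
    and nonneg: "AE y in M. 0 \<le> y"
    and sq: "integrable M (\<lambda>y. y\<^sup>2)"
  shows "has_bochner_integral lborel
    (\<lambda>x. indicator {0..} x * x * (LINT y|M. indicator {x<..} y * h y)) ((LINT y|M. y\<^sup>2 * h y) / 2)"
proof -
  interpret P: pair_sigma_finite M lborel ..
  let ?f = "\<lambda>y x. indicator {0..} x * x * (indicator {x<..} y * h y)"
  have inner: "has_bochner_integral lborel (?f y) (y\<^sup>2 / 2 * h y)" if "0 \<le> y" for y
  proof -
    have "has_bochner_integral lborel (\<lambda>x. indicator {0..y} x *\<^sub>R x) (y\<^sup>2 / 2 - 0\<^sup>2 / 2)"
      using that by (intro has_bochner_integral_FTC_Icc)
        (auto intro!: derivative_eq_intros continuous_intros
              simp flip: has_real_derivative_iff_has_vector_derivative)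
    then have "has_bochner_integral lborel (\<lambda>x. indicator {0..y} x *\<^sub>R x * h y) (y\<^sup>2 / 2 * h y)"
      by (intro has_bochner_integral_mult_left) auto
    \<comment> \<open>The antiderivative gave the closed interval up to \<open>y\<close>, while
      \<open>?f\<close> requires \<open>x < y\<close>; the endpoint is Lebesgue-null.\<close>
    moreover have "AE x in lborel. x \<noteq> y"
      by (rule AE_lborel_singleton)
    then have "AE x in lborel. indicator {0..y} x *\<^sub>R x * h y = ?f y x"
      by eventually_elim (auto simp: indicator_def)
    moreover have "(\<lambda>x. ?f y x) \<in> borel_measurable lborel"
      by (simp add: indicator_def)
    ultimately show ?thesis
      using has_bochner_integral_cong_AE[of "\<lambda>x. indicator {0..y} x *\<^sub>R x * h y" lborel "?f y"] by simp
  qed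
  have meas: "(\<lambda>(y, x). ?f y x) \<in> borel_measurable (M \<Otimes>\<^sub>M lborel)"
    by (simp add: indicator_def split_beta)
  then have meas_int: "(\<lambda>y. LINT x|lborel. ?f y x) \<in> borel_measurable M"
    by (rule lborel.borel_measurable_lebesgue_integral)
  have eq: "AE y in M. (LINT x|lborel. ?f y x) = y\<^sup>2 / 2 * h y"
    using nonneg by eventually_elim (rule has_bochner_integral_integral_eq[OF inner])
  have "integrable M (\<lambda>y. y\<^sup>2 * h y)"
    by (rule Bochner_Integration.integrable_bound[OF sq])
      (auto simp: abs_mult h intro!: mult_left_le)
  then have sqh: "integrable M (\<lambda>y. y\<^sup>2 / 2 * h y)"
    by simp
  \<comment> \<open>By non-negativity, the iterated integral of the norm is that of
    \<open>y^2 / 2 * h y\<close>, finite by the second moment and \<open>h \<le> 1\<close>. This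
    justifies Fubini.\<close>
  have norm: "norm (?f y x) = ?f y x" for x y
    by (auto simp: indicator_def h)
  have int: "integrable (M \<Otimes>\<^sub>M lborel) (\<lambda>(y, x). ?f y x)"
  proof (rule P.Fubini_integrable)
    show "integrable M (\<lambda>y. LINT x|lborel. norm (case (y, x) of (y, x) \<Rightarrow> ?f y x))"
      unfolding prod.case norm
      using integrable_cong_AE[OF meas_int _ eq] sqh by simp
    show "AE y in M. integrable lborel (\<lambda>x. case (y, x) of (y, x) \<Rightarrow> ?f y x)"
      using nonneg unfolding prod.case by eventually_elim (rule integrable.intros[OF inner])
  qed (rule meas)
  have "(LINT x|lborel. LINT y|M. ?f y x) = (LINT y|M. LINT x|lborel. ?f y x)"
    by (rule P.Fubini_integral[OF int])
  also have "\<dots> = (LINT y|M. y\<^sup>2 / 2 * h y)"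
    by (rule integral_cong_AE[OF meas_int _ eq]) simp
  finally have "(LINT x|lborel. LINT y|M. ?f y x) = (LINT y|M. y\<^sup>2 * h y) / 2"
    by simp
  then show ?thesis
    using P.integrable_snd[OF int] by (simp add: has_bochner_integral_iff)
qed

text \<open>With \<open>h = G^n\<close> the inner integral is \<open>G(x)^(n+1) / (n+1)\<close>, and
  multiplying by \<open>Suc n\<close> clears the denominator. Integrability is kept in the
  conclusion so that two instances can be subtracted.\<close>

lemma has_bochner_integral_tail_power:
  assumes "\<And>x. measure M {x} = 0"
    and "AE y in M. 0 \<le> y"
    and "integrable M (\<lambda>y. y\<^sup>2)"
  shows "has_bochner_integral lborel
    (\<lambda>x. indicator {0..} x * x * measure M {x<..} ^ Suc n)
    (real (Suc n) / 2 * (LINT y|M. y\<^sup>2 * measure M {y<..} ^ n))"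
proof -
  have "has_bochner_integral lborel
      (\<lambda>x. indicator {0..} x * x * (LINT y|M. indicator {x<..} y * measure M {y<..} ^ n))
      ((LINT y|M. y\<^sup>2 * measure M {y<..} ^ n) / 2)"
    by (rule has_bochner_integral_tail_expectation) (use assms in \<open>auto simp: power_le_one\<close>)
  from has_bochner_integral_mult_right[OF this, of "real (Suc n)"] show ?thesis
    unfolding integral_tail_power[OF assms(1)] by (simp add: field_simps del: of_nat_Suc)
qed

end

theorem mainTheorem12:
  fixes M :: "'a measure" and X :: "'a \<Rightarrow> real" and \<alpha> :: nat
  assumes "prob_space M"
    and "X \<in> borel_measurable M"
    and "AE \<omega> in M. 0 \<le> X \<omega>"
    and "abs_continuous_on UNIV (distr_fun M X)"
    and "integrable M (\<lambda>\<omega>. (X \<omega>)\<^sup>2)"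
    and "0 < \<alpha>" and "\<alpha> \<noteq> 1"
  shows "WCRT M (real \<alpha>) X =
           1 / (2 * (real \<alpha> - 1)) * prob_weighted_moment M X 2 0 0
           - real \<alpha> / (2 * (real \<alpha> - 1)) * prob_weighted_moment M X 2 0 (real \<alpha> - 1)"
proof -
  interpret prob_space M by fact
  note [measurable] = assms(2)
  let ?D = "distr M borel X"
  interpret D: real_distribution ?D
    by (rule real_distribution_distr) fact
  let ?G = "\<lambda>x. measure ?D {x<..}"
  obtain n where \<alpha>: "\<alpha> = Suc n"
    using \<open>0 < \<alpha>\<close> by (cases \<alpha>) auto
  have no_atom: "measure ?D {x} = 0" for x
    using abs_continuous_on_imp_isCont[OF assms(4)] by (simp add: distr_fun_def D.isCont_cdf)
  have nonneg: "AE y in ?D. 0 \<le> y"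
    using assms(3) by (simp add: AE_distr_iff)
  have sq: "integrable ?D (\<lambda>y. y\<^sup>2)"
    using assms(5) by (simp add: integrable_distr_eq)
  have surv: "1 - distr_fun M X x = ?G x" for x
    by (simp add: distr_fun_def D.cdf_eq_measure_tail)
  \<comment> \<open>The factor with exponent 0 is 1 even where the distribution function vanishes,
    by the convention in \<open>rpow\<close>. Rewriting \<open>rpow (X \<omega>) 2\<close> as a
    square uses \<open>0 \<le> X \<omega>\<close>, known only almost everywhere.\<close>
  have moment: "prob_weighted_moment M X 2 0 (real k) = (LINT y|?D. y\<^sup>2 * ?G y ^ k)" for k
  proof -
    have "prob_weighted_moment M X 2 0 (real k) = (LINT \<omega>|M. rpow (X \<omega>) (real 2) * ?G (X \<omega>) ^ k)"
      unfolding prob_weighted_moment_def surv by (simp add: rpow_of_nat rpow_def[of _ 0])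
    also have "\<dots> = (LINT \<omega>|M. (X \<omega>)\<^sup>2 * ?G (X \<omega>) ^ k)"
    proof (rule integral_cong_AE)
      show "AE \<omega> in M. rpow (X \<omega>) (real 2) * ?G (X \<omega>) ^ k = (X \<omega>)\<^sup>2 * ?G (X \<omega>) ^ k"
        using assms(3) by eventually_elim (simp only: rpow_of_nat)
    qed (simp_all add: rpow_def)
    also have "\<dots> = (LINT y|?D. y\<^sup>2 * ?G y ^ k)"
      by (subst integral_distr) auto
    finally show ?thesis .
  qed
  note tail = D.has_bochner_integral_tail_power[OF no_atom nonneg sq]
  \<comment> \<open>The instances at 0 and \<open>n\<close> carry the powers 1 and
    \<open>\<alpha> = n + 1\<close> of the survival function; their moments have exponents 0 and
    \<open>n = \<alpha> - 1\<close>.\<close>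
  have "has_bochner_integral lborel
      (\<lambda>x. indicator {0..} x * x * ?G x ^ Suc 0 - indicator {0..} x * x * ?G x ^ \<alpha>)
      (1 / 2 * prob_weighted_moment M X 2 0 0 - real \<alpha> / 2 * prob_weighted_moment M X 2 0 (real \<alpha> - 1))"
    using has_bochner_integral_diff[OF tail[of 0] tail[of n]] moment[of 0] moment[of n]
    unfolding \<alpha> by simp
  moreover have "indicator {0..} x * x * ?G x ^ Suc 0 - indicator {0..} x * x * ?G x ^ \<alpha> =
      indicator {0..} x *\<^sub>R (x * (surv_fun M X x - rpow (surv_fun M X x) (real \<alpha>)))" for x
    by (simp add: surv_fun_def surv rpow_of_nat algebra_simps)
  ultimately have "(LINT x:{0..}|lborel. x * (surv_fun M X x - rpow (surv_fun M X x) (real \<alpha>))) =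
      1 / 2 * prob_weighted_moment M X 2 0 0 - real \<alpha> / 2 * prob_weighted_moment M X 2 0 (real \<alpha> - 1)"
    unfolding set_lebesgue_integral_def by (simp add: has_bochner_integral_iff)
  then show ?thesis
    unfolding WCRT_def by (simp only:) (simp add: right_diff_distrib mult.commute)
qed

end
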